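(* Let $A$, $B$, $X$ be metric spaces, let $\pi: A \to B$ be a soft quotient map with scattered fibres, let $p: X\to[-1,\infty)$ be a coarse map, let $f: I_pX \to B$ be a coarse homotopy (i.e. a coarse map) and let $f_0: X \to A$ be a coarse map such that $f\circ i_0 = \pi\circ f_0$. Then there is a coarse homotopy $\tilde{f}: I_pX \to A$ such that $\tilde f\circ i_0 = f_0$ and $\pi\circ\tilde f = f$. Moreover, if $\tilde{f}, \tilde{f}': I_pX\to A$ are two coarse homotopies with $\tilde f\circ i_0 = \tilde f'\circ i_0= f_0$ and $\pi\circ\tilde f = \pi\circ\tilde f' = f$, then there is a bounded set $K$ in $I_pX$ such that $\tilde{f} |_{I_pX \setminus K} = \tilde{f}' |_{I_pX \setminus K}$.
   Context: $\mathbb{R}_+=[0,\infty)\subseteq\mathbb{R}$. A map $f:X\to Y$ between metric spaces is bornologous if there is a non-decreasing function $\rho:\mathbb{R}_+\to\mathbb{R}_+$ (a control function) with $d(f(x),f(x'))\le\rho(d(x,x'))$ for all $x,x'\in X$. It is coarse if it is bornologous and the inverse image of every bounded set is bounded. For a metric space $X$ and a function $p:X\to[-1,\infty)$, the $p$-cylinder is $I_pX=\{(x,t)\in X\times\mathbb{R}_+ : t\le p(x)+1\}$ with the $\ell^2$ metric; $i_0:X\to I_pX$ is $i_0(x)=(x,0)$. A coarse homotopy is a coarse map $H:I_pX\to Y$ for some coarse map $p:X\to[-1,\infty)$. A bornologous map $f:X\to Y$ is a soft quotient map if it is surjective and for every $R>0$ there is an $S>0$ such that if $d(f(x),y)\le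 R$ for some $x\in X$, $y\in Y$, then there is $x'\in f^{-1}(y)$ with $d(x,x')\le S$. A map $f:X\to Y$ has scattered fibres if for every $R>0$ there is a bounded set $K\subseteq Y$ such that if $f(x)=f(x')\notin K$ for $x,x'\in X$ and $d(x,x')\le R$, then $x=x'$. *)

theory Defs
  imports "HOL-Analysis.Analysis"
begin

text \<open>Metric spaces are values of the library type of abstract metrics, with carrier
  \<^const>\<open>mspace\<close> and distance \<^const>\<open>mdist\<close>; the carrier may be empty.  A map
  between metric spaces is a total function that is only constrained on the carrier.\<close>

definition bounded_in :: "'a metric \<Rightarrow> 'a set \<Rightarrow> bool" where
  "bounded_in X K \<longleftrightarrow> Metric_space.mbounded (mspace X) (mdist X) K"

definition control_function :: "(real \<Rightarrow> real) \<Rightarrow> bool" where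
  "control_function \<rho> \<longleftrightarrow> \<rho> \<in> {0..} \<rightarrow> {0..} \<and> mono_on {0..} \<rho>"

definition bornologous_map :: "'a metric \<Rightarrow> 'b metric \<Rightarrow> ('a \<Rightarrow> 'b) \<Rightarrow> bool" where
  "bornologous_map X Y f \<longleftrightarrow> f \<in> mspace X \<rightarrow> mspace Y \<and>
     (\<exists>\<rho>. control_function \<rho> \<and>
        (\<forall>x\<in>mspace X. \<forall>x'\<in>mspace X. mdist Y (f x) (f x') \<le> \<rho> (mdist X x x')))"

definition coarse_map :: "'a metric \<Rightarrow> 'b metric \<Rightarrow> ('a \<Rightarrow> 'b) \<Rightarrow> bool" where
  "coarse_map X Y f \<longleftrightarrow> bornologous_map X Y f \<and>
     (\<forall>K. bounded_in Y K \<longrightarrow> bounded_in X (f -` K \<inter> mspace X))"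

definition ray_metric :: "real \<Rightarrow> real metric" where
  "ray_metric a = submetric euclidean_metric {a..}"

text \<open>The library's \<^const>\<open>prod_metric\<close> is the $\ell^2$ product metric.\<close>

definition cylinder :: "'a metric \<Rightarrow> ('a \<Rightarrow> real) \<Rightarrow> ('a \<times> real) metric" where
  "cylinder X p = submetric (prod_metric X (ray_metric 0)) {(x, t). t \<le> p x + 1}"

definition cyl_incl :: "'a \<Rightarrow> 'a \<times> real" where
  "cyl_incl x = (x, 0)"

definition coarse_homotopy ::
    "'a metric \<Rightarrow> ('a \<Rightarrow> real) \<Rightarrow> 'b metric \<Rightarrow> ('a \<times> real \<Rightarrow> 'b) \<Rightarrow> bool" where
  "coarse_homotopy X p Y H \<longleftrightarrow>
     coarse_map X (ray_metric (-1)) p \<and> coarse_map (cylinder X p) Y H"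

definition soft_quotient_map :: "'a metric \<Rightarrow> 'b metric \<Rightarrow> ('a \<Rightarrow> 'b) \<Rightarrow> bool" where
  "soft_quotient_map X Y f \<longleftrightarrow> bornologous_map X Y f \<and> f ` mspace X = mspace Y \<and>
     (\<forall>R>0. \<exists>S>0. \<forall>x\<in>mspace X. \<forall>y\<in>mspace Y. mdist Y (f x) y \<le> R \<longrightarrow>
        (\<exists>x'\<in>mspace X. f x' = y \<and> mdist X x x' \<le> S))"

definition scattered_fibres :: "'a metric \<Rightarrow> 'b metric \<Rightarrow> ('a \<Rightarrow> 'b) \<Rightarrow> bool" where
  "scattered_fibres X Y f \<longleftrightarrow>
     (\<forall>R>0. \<exists>K. bounded_in Y K \<and>
        (\<forall>x\<in>mspace X. \<forall>x'\<in>mspace X.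
           f x = f x' \<and> f x \<notin> K \<and> mdist X x x' \<le> R \<longrightarrow> x = x'))"

lemma mspace_cylinder:
  "mspace (cylinder X p) = {(x, t). x \<in> mspace X \<and> 0 \<le> t \<and> t \<le> p x + 1}"
  by (auto simp: cylinder_def ray_metric_def)

lemma mdist_cylinder:
  "mdist (cylinder X p) (x, s) (y, t) = sqrt ((mdist X x y)\<^sup>2 + (s - t)\<^sup>2)"
  by (simp add: cylinder_def ray_metric_def prod_dist_def dist_real_def)

end

theory Submission
  imports Defs
begin

text \<open>Lift each column of the cylinder step by step: starting from \<open>f0 x\<close>, choose
  preimages of \<open>f (x, 1)\<close>, \<open>f (x, 2)\<close> and so on, each within a fixed distance \<open>S\<close> of its predecessor.
  For two nearby columns, softness provides a point over \<open>f (y, n)\<close> close to the lift of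
  \<open>f (x, n)\<close>; by induction on \<open>n\<close> it is also within a controlled distance of the chosen lift of
  \<open>f (y, n)\<close>, so by scatteredness it is that lift, unless \<open>f (y, n)\<close> lies in a bounded set
  \<open>K\<close>.  As the constant obtained does not depend on \<open>n\<close>, the induction does not deteriorate.
  The columns that meet the preimage of \<open>K\<close> have bounded height, and there the crude estimate by
  the number of steps suffices.  The same argument along a column shows that two lifts can
  only differ on columns that meet the preimage of a bounded set.\<close>

section \<open>Bounded sets and bornologous maps\<close>

lemma bounded_in_alt:
  "bounded_in X K \<longleftrightarrow> K \<subseteq> mspace X \<and> (\<exists>b. \<forall>x\<in>K. \<forall>y\<in>K. mdist X x y \<le> b)"
  unfolding bounded_in_def by (rule Metric_space.mbounded_alt[OF Metric_space_mspace_mdist])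

text \<open>By monotonicity, \<open>\<rho> R\<close> bounds every displacement at scale
  \<open>R\<close>. Conversely, the supremum of the displacements at scale \<open>r\<close> is
  non-decreasing in \<open>r\<close> and serves as a control function.\<close>

lemma bornologous_map_alt:
  "bornologous_map X Y f \<longleftrightarrow> f \<in> mspace X \<rightarrow> mspace Y \<and>
    (\<forall>R. \<exists>C. \<forall>x\<in>mspace X. \<forall>x'\<in>mspace X. mdist X x x' \<le> R \<longrightarrow> mdist Y (f x) (f x') \<le> C)"
    (is "?L \<longleftrightarrow> ?F \<and> ?R")
proof (intro iffI conjI)
  assume L: ?L
  then show ?F by (simp add: bornologous_map_def)
  from L obtain \<rho> where \<rho>: "mono_on {0..} \<rho>"
    "\<forall>x\<in>mspace X. \<forall>x'\<in>mspace X. mdist Y (f x) (f x') \<le> \<rho> (mdist X x x')"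
    by (auto simp: bornologous_map_def control_function_def)
  have "mdist Y (f x) (f x') \<le> \<rho> R"
    if "x \<in> mspace X" "x' \<in> mspace X" "mdist X x x' \<le> R" for R x x'
  proof -
    have "0 \<le> R" by (rule order_trans[OF mdist_nonneg that(3)])
    then have "\<rho> (mdist X x x') \<le> \<rho> R"
      using that(3) \<open>0 \<le> R\<close> by (intro mono_onD[OF \<rho>(1)]) simp_all
    then show ?thesis using \<rho>(2) that(1,2) order_trans by blast
  qed
  then show ?R by (intro allI exI[of _ "\<rho> R" for R] ballI impI)
next
  assume R: "?F \<and> ?R"
  \<comment> \<open>The inserted 0 keeps \<open>V r\<close> nonempty and its supremum non-negative,
    even for an empty carrier.\<close>
  define V where "V r = insert 0 {mdist Y (f x) (f x') | x x'.
      x \<in> mspace X \<and> x' \<in> mspace X \<and> mdist X x x' \<le> r}" for r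
  have bdd: "bdd_above (V r)" for r
  proof -
    obtain C where "\<forall>x\<in>mspace X. \<forall>x'\<in>mspace X. mdist X x x' \<le> r \<longrightarrow> mdist Y (f x) (f x') \<le> C"
      using R by blast
    then show ?thesis by (intro bdd_aboveI[of _ "max 0 C"]) (auto simp: V_def le_max_iff_disj)
  qed
  have "control_function (\<lambda>r. Sup (V r))"
    unfolding control_function_def
  proof (intro conjI funcsetI mono_onI)
    show "Sup (V r) \<in> {0..}" for r
      using cSup_upper[OF _ bdd, of 0 r] by (simp add: V_def)
    show "Sup (V r) \<le> Sup (V s)" if "r \<le> s" for r s
      using that by (intro cSup_subset_mono bdd) (auto simp: V_def intro: order_trans)
  qed
  moreover have "mdist Y (f x) (f x') \<le> Sup (V (mdist X x x'))"
    if "x \<in> mspace X" "x' \<in> mspace X" for x x'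
    using that by (intro cSup_upper bdd) (auto simp: V_def)
  ultimately show ?L
    using R unfolding bornologous_map_def by (intro conjI exI[of _ "\<lambda>r. Sup (V r)"]) simp_all
qed

text \<open>The bound is made positive so that it can be used as a scale in softness and
  scatteredness, which quantify over positive reals.\<close>

lemma bornologous_mapD:
  assumes "bornologous_map X Y f"
  obtains C where "C > 0"
    "\<And>x x'. \<lbrakk>x \<in> mspace X; x' \<in> mspace X; mdist X x x' \<le> R\<rbrakk> \<Longrightarrow> mdist Y (f x) (f x') \<le> C"
proof -
  obtain C where C: "\<forall>x\<in>mspace X. \<forall>x'\<in>mspace X. mdist X x x' \<le> R \<longrightarrow> mdist Y (f x) (f x') \<le> C"
    using assms unfolding bornologous_map_alt by blast
  show thesis by (rule that[of "max 1 C"]) (use C in \<open>auto simp: le_max_iff_disj\<close>)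
qed

lemma bounded_in_image:
  assumes "bornologous_map X Y f" "bounded_in X K"
  shows "bounded_in Y (f ` K)"
proof -
  obtain b where b: "K \<subseteq> mspace X" "\<forall>x\<in>K. \<forall>y\<in>K. mdist X x y \<le> b"
    using assms(2) unfolding bounded_in_alt by blast
  obtain C where C: "\<And>x x'. \<lbrakk>x \<in> mspace X; x' \<in> mspace X; mdist X x x' \<le> b\<rbrakk>
      \<Longrightarrow> mdist Y (f x) (f x') \<le> C"
    using bornologous_mapD[OF assms(1)] by blast
  have "f ` K \<subseteq> mspace Y" using b assms(1) by (auto simp: bornologous_map_alt)
  moreover have "\<forall>u\<in>f ` K. \<forall>v\<in>f ` K. mdist Y u v \<le> C" using b C by blast
  ultimately show ?thesis unfolding bounded_in_alt by blast
qed

lemma bounded_in_subset: "\<lbrakk>bounded_in X L; K \<subseteq> L\<rbrakk> \<Longrightarrow> bounded_in X K"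
  unfolding bounded_in_alt by blast

text \<open>Properness passes from \<open>f\<close> to its lift: the preimage of \<open>K\<close>
  under \<open>g\<close> lies in the preimage of \<open>\<pi>\<close>
  K\<open>under\<close>f\<open>, and\<close>\<pi> \<open>K\<close> is bounded.\<close>

lemma coarse_map_comp_factor:
  assumes "bornologous_map A B \<pi>" "bornologous_map Z A g" "coarse_map Z B f"
    and "\<And>z. z \<in> mspace Z \<Longrightarrow> \<pi> (g z) = f z"
  shows "coarse_map Z A g"
  unfolding coarse_map_def
proof (intro conjI allI impI)
  fix K assume "bounded_in A K"
  then have "bounded_in Z (f -` (\<pi> ` K) \<inter> mspace Z)"
    using assms(3) bounded_in_image[OF assms(1)] by (simp add: coarse_map_def)
  then show "bounded_in Z (g -` K \<inter> mspace Z)"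
    by (rule bounded_in_subset) (use assms(4) in force)
qed fact

section \<open>Columns of the cylinder\<close>

text \<open>Lifts are compared by climbing from height 0, so a bad value at one height spoils the
  column; hence whole columns are discarded.\<close>

definition column_saturation :: "'x metric \<Rightarrow> ('x \<Rightarrow> real) \<Rightarrow> ('x \<times> real) set \<Rightarrow> ('x \<times> real) set"
  where "column_saturation X p L = {(x, t) \<in> mspace (cylinder X p). \<exists>s. (x, s) \<in> L}"

lemma mdist_refl [simp]: "x \<in> mspace X \<Longrightarrow> mdist X x x = 0"
  by simp

lemma mdist_cylinder_vertical [simp]: "mdist (cylinder X p) (x, s) (x, t) = \<bar>s - t\<bar>"
  if "x \<in> mspace X"
  using that by (simp add: mdist_cylinder)

lemma mdist_cylinder_ge:
  "mdist X x y \<le> mdist (cylinder X p) (x, s) (y, t)"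
  "\<bar>s - t\<bar> \<le> mdist (cylinder X p) (x, s) (y, t)"
  by (auto simp: mdist_cylinder intro!: real_le_rsqrt)

text \<open>The base points of \<open>L\<close> are within \<open>b\<close> of each other, so
  \<open>p\<close> varies by at most \<open>C\<close> from its value at a fixed \<open>x0\<close>;
  this bounds the heights of all columns meeting \<open>L\<close>.\<close>

lemma bounded_in_column_saturation:
  assumes p: "bornologous_map X (ray_metric (-1)) p" and L: "bounded_in (cylinder X p) L"
  shows "bounded_in (cylinder X p) (column_saturation X p L)"
proof -
  obtain b where b: "L \<subseteq> mspace (cylinder X p)" "\<forall>z\<in>L. \<forall>w\<in>L. mdist (cylinder X p) z w \<le> b"
    using L unfolding bounded_in_alt by blast
  obtain C where C: "\<And>x x'. \<lbrakk>x \<in> mspace X; x' \<in> mspace X; mdist X x x' \<le> b\<rbrakk>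
      \<Longrightarrow> \<bar>p x - p x'\<bar> \<le> C"
    using bornologous_mapD[OF p, of b] unfolding ray_metric_def mdist_submetric
      mdist_euclidean_metric dist_real_def by blast
  show ?thesis
  proof (cases "L = {}")
    case True
    then show ?thesis by (simp add: bounded_in_alt column_saturation_def)
  next
    case False
    then obtain x0 s0 where x0: "(x0, s0) \<in> L" by auto
    have near: "mdist X x y \<le> b" if "(x, s) \<in> L" "(y, t) \<in> L" for x s y t
      using mdist_cylinder_ge(1) b(2) that by (meson order_trans)
    have height: "x \<in> mspace X \<and> 0 \<le> t \<and> t \<le> p x0 + 1 + C"
      if xt: "(x, t) \<in> column_saturation X p L" for x t
    proof -
      obtain s where s: "(x, s) \<in> L" and t: "x \<in> mspace X" "0 \<le> t" "t \<le> p x + 1"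
        using xt by (auto simp: column_saturation_def mspace_cylinder)
      have "x0 \<in> mspace X" using x0 b(1) by (auto simp: mspace_cylinder)
      then have "\<bar>p x - p x0\<bar> \<le> C" using near[OF s x0] C t by blast
      then show ?thesis using t by linarith
    qed
    have "mdist (cylinder X p) z w \<le> b + (p x0 + 1 + C)"
      if "z \<in> column_saturation X p L" "w \<in> column_saturation X p L" for z w
    proof -
      obtain x s y t where zw: "z = (x, s)" "w = (y, t)" by (cases z, cases w)
      have "mdist X x y \<le> b"
        using that near unfolding zw column_saturation_def by blast
      moreover have "\<bar>s - t\<bar> \<le> p x0 + 1 + C"
        using height that unfolding zw by (smt (verit))
      moreover have "mdist (cylinder X p) z w \<le> \<bar>mdist X x y\<bar> + \<bar>s - t\<bar>"
        unfolding zw mdist_cylinder by (rule sqrt_sum_squares_le_sum_abs)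
      ultimately show ?thesis by simp
    qed
    moreover have "column_saturation X p L \<subseteq> mspace (cylinder X p)"
      by (auto simp: column_saturation_def)
    ultimately show ?thesis
      unfolding bounded_in_alt by (intro conjI exI[of _ "b + (p x0 + 1 + C)"]) simp_all
  qed
qed

lemma bounded_in_column_saturation_vimage:
  assumes "coarse_homotopy X p B f" "bounded_in B K"
  shows "bounded_in (cylinder X p)
    (column_saturation X p (f -` K \<inter> mspace (cylinder X p)))"
  using assms by (intro bounded_in_column_saturation) (auto simp: coarse_homotopy_def coarse_map_def)

text \<open>The diameter of the saturation bounds the distance from \<open>(x, t)\<close> to the
  bottom point \<open>(x, 0)\<close> of its column, which is \<open>t\<close>.\<close>

lemma bounded_column_height:
  assumes "coarse_homotopy X p B f" "bounded_in B K"
  obtains h where "\<And>x s t. \<lbrakk>(x, s) \<in> mspace (cylinder X p); f (x, s) \<in> K;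
    (x, t) \<in> mspace (cylinder X p)\<rbrakk> \<Longrightarrow> t \<le> h"
proof -
  let ?D = "column_saturation X p (f -` K \<inter> mspace (cylinder X p))"
  obtain h where h: "\<forall>z\<in>?D. \<forall>w\<in>?D. mdist (cylinder X p) z w \<le> h"
    using bounded_in_column_saturation_vimage[OF assms] unfolding bounded_in_alt by blast
  show thesis
  proof (rule that)
    fix x s t
    assume a: "(x, s) \<in> mspace (cylinder X p)" "f (x, s) \<in> K" "(x, t) \<in> mspace (cylinder X p)"
    then have "(x, t) \<in> ?D" "(x, 0) \<in> ?D"
      by (auto simp: column_saturation_def mspace_cylinder)
    then have "mdist (cylinder X p) (x, t) (x, 0) \<le> h" using h by blast
    then show "t \<le> h" using mdist_cylinder_ge(2)[of t 0 X p x x] by linarith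
  qed
qed

section \<open>Uniqueness of lifts outside a bounded set\<close>

text \<open>Equality propagates upwards: over a step of height at most 1 from a common value, the
  lifts move by at most \<open>C\<close> and \<open>C'\<close>, so they reach points of one fibre at
  distance at most \<open>C + C'\<close>.\<close>

lemma coarse_homotopy_lifts_eq:
  assumes sf: "scattered_fibres A B \<pi>" and f: "coarse_homotopy X p B f"
    and g: "coarse_homotopy X p A g" and g': "coarse_homotopy X p A g'"
    and start: "\<And>x. x \<in> mspace X \<Longrightarrow> g (x, 0) = g' (x, 0)"
    and lift: "\<And>z. z \<in> mspace (cylinder X p) \<Longrightarrow> \<pi> (g z) = f z"
    and lift': "\<And>z. z \<in> mspace (cylinder X p) \<Longrightarrow> \<pi> (g' z) = f z"
  shows "\<exists>K. bounded_in (cylinder X p) K \<and> (\<forall>z\<in>mspace (cylinder X p) - K. g z = g' z)"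
proof -
  let ?Z = "cylinder X p"
  have bg: "bornologous_map ?Z A g" "bornologous_map ?Z A g'"
    using g g' by (auto simp: coarse_homotopy_def coarse_map_def)
  then have mem: "g z \<in> mspace A" "g' z \<in> mspace A" if "z \<in> mspace ?Z" for z
    using that by (auto simp: bornologous_map_alt)
  obtain C where C: "C > 0" "\<And>z w. \<lbrakk>z \<in> mspace ?Z; w \<in> mspace ?Z; mdist ?Z z w \<le> 1\<rbrakk>
      \<Longrightarrow> mdist A (g z) (g w) \<le> C"
    using bornologous_mapD[OF bg(1)] by blast
  obtain C' where C': "C' > 0" "\<And>z w. \<lbrakk>z \<in> mspace ?Z; w \<in> mspace ?Z; mdist ?Z z w \<le> 1\<rbrakk>
      \<Longrightarrow> mdist A (g' z) (g' w) \<le> C'"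
    using bornologous_mapD[OF bg(2)] by blast
  obtain K where K: "bounded_in B K" "\<And>a a'. \<lbrakk>a \<in> mspace A; a' \<in> mspace A; \<pi> a = \<pi> a';
      \<pi> a \<notin> K; mdist A a a' \<le> C + C'\<rbrakk> \<Longrightarrow> a = a'"
    using sf C(1) C'(1) unfolding scattered_fibres_def by (metis add_pos_pos)
  let ?D = "column_saturation X p (f -` K \<inter> mspace ?Z)"
  have "g (x, t) = g' (x, t)" if xt: "(x, t) \<in> mspace ?Z - ?D" for x t
  proof -
    have x: "x \<in> mspace X" using xt by (auto simp: mspace_cylinder)
    have out: "f (x, s) \<notin> K" if "(x, s) \<in> mspace ?Z" for s
      using xt that by (auto simp: column_saturation_def)
    \<comment> \<open>The induction covers all real heights up to \<open>n\<close>, not just the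
      integer ones.\<close>
    have "\<lbrakk>0 \<le> s; s \<le> real n; s \<le> t\<rbrakk> \<Longrightarrow> g (x, s) = g' (x, s)" for n s
    proof (induction n arbitrary: s)
      case 0
      then show ?case using start x by simp
    next
      case (Suc n)
      \<comment> \<open>One unit below \<open>s\<close>, truncated at the bottom of the
        cylinder.\<close>
      define r where "r = max 0 (s - 1)"
      have r: "0 \<le> r" "r \<le> real n" "r \<le> s" "\<bar>s - r\<bar> \<le> 1" using Suc.prems by (auto simp: r_def)
      have Z: "(x, s) \<in> mspace ?Z" "(x, r) \<in> mspace ?Z"
        using xt Suc.prems r by (auto simp: mspace_cylinder)
      have eq: "g (x, r) = g' (x, r)" using Suc r by auto
      have "mdist A (g (x, s)) (g' (x, s))
          \<le> mdist A (g (x, s)) (g (x, r)) + mdist A (g' (x, r)) (g' (x, s))"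
        using mdist_triangle mem Z eq by metis
      also have "\<dots> \<le> C + C'"
        using r x Z by (intro add_mono C(2) C'(2)) auto
      finally show ?case
        using K(2) mem Z lift lift' out by metis
    qed
    moreover obtain n where "t \<le> real n" using real_arch_simple by blast
    ultimately show ?thesis using xt by (auto simp: mspace_cylinder)
  qed
  then show ?thesis using bounded_in_column_saturation_vimage[OF f K(1)] by fast
qed

section \<open>Existence of a lift\<close>

text \<open>The recursion \<open>h\<close> runs over integer heights only; \<open>g\<close> at
  height \<open>t\<close> adds one selection starting from \<open>h\<close> at the floor of
  \<open>t\<close>. Bounds across columns at equal integer height and along a column together make
  \<open>g\<close> bornologous.\<close>

lemma coarse_homotopy_lift_exists:
  assumes sq: "soft_quotient_map A B \<pi>" and sf: "scattered_fibres A B \<pi>"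
    and f: "coarse_homotopy X p B f" and f0: "bornologous_map X A f0"
    and start: "\<And>x. x \<in> mspace X \<Longrightarrow> \<pi> (f0 x) = f (x, 0)"
  obtains g where "coarse_homotopy X p A g" "\<And>x. x \<in> mspace X \<Longrightarrow> g (x, 0) = f0 x"
    "\<And>z. z \<in> mspace (cylinder X p) \<Longrightarrow> \<pi> (g z) = f z"
proof -
  let ?Z = "cylinder X p"
  have bf: "bornologous_map ?Z B f" and bp: "bornologous_map X (ray_metric (-1)) p"
    using f by (auto simp: coarse_homotopy_def coarse_map_def)
  have memf: "f z \<in> mspace B" if "z \<in> mspace ?Z" for z
    using bf that by (auto simp: bornologous_map_alt)
  have memf0: "f0 x \<in> mspace A" if "x \<in> mspace X" for x
    using f0 that by (auto simp: bornologous_map_alt)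
  \<comment> \<open>\<open>Q\<close> bounds the displacement of \<open>f\<close> over a unit step,
    and \<open>S\<close> is the softness constant for \<open>Q\<close>: each unit step lifts with
    displacement at most \<open>S\<close>.\<close>
  obtain Q where Q: "Q > 0" "\<And>z w. \<lbrakk>z \<in> mspace ?Z; w \<in> mspace ?Z; mdist ?Z z w \<le> 1\<rbrakk>
      \<Longrightarrow> mdist B (f z) (f w) \<le> Q"
    using bornologous_mapD[OF bf] by blast
  obtain S where S: "S > 0" "\<And>a b. \<lbrakk>a \<in> mspace A; b \<in> mspace B; mdist B (\<pi> a) b \<le> Q\<rbrakk>
      \<Longrightarrow> \<exists>a'\<in>mspace A. \<pi> a' = b \<and> mdist A a a' \<le> S"
    using sq Q(1) unfolding soft_quotient_map_def by metis
  define sel where "sel a b = (SOME a'. a' \<in> mspace A \<and> \<pi> a' = b \<and> mdist A a a' \<le> S)" for a b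
  have sel: "sel a (f z) \<in> mspace A \<and> \<pi> (sel a (f z)) = f z \<and> mdist A a (sel a (f z)) \<le> S"
    if "a \<in> mspace A" "\<pi> a = f w" "z \<in> mspace ?Z" "w \<in> mspace ?Z" "mdist ?Z w z \<le> 1" for a z w
  proof -
    have "\<exists>a'. a' \<in> mspace A \<and> \<pi> a' = f z \<and> mdist A a a' \<le> S"
      using S(2)[OF that(1) memf[OF that(3)]] Q(2) that by auto
    then show ?thesis unfolding sel_def by (rule someI_ex)
  qed
  \<comment> \<open>Above the top of a column the values of \<open>h\<close> are arbitrary, so every
    fact about \<open>h x n\<close> assumes that \<open>(x, real n)\<close> lies in the
    cylinder.\<close>
  define h where "h x n = rec_nat (f0 x) (\<lambda>k a. sel a (f (x, real (Suc k)))) n" for x n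
  have h_simps: "h x 0 = f0 x" "h x (Suc n) = sel (h x n) (f (x, real (Suc n)))" for x n
    by (simp_all add: h_def)
  have h: "h x n \<in> mspace A \<and> \<pi> (h x n) = f (x, real n)"
    if "(x, real n) \<in> mspace ?Z" for x n
    using that
  proof (induction n)
    case 0
    then show ?case using memf0 start by (simp add: h_simps mspace_cylinder)
  next
    case (Suc n)
    then have "(x, real n) \<in> mspace ?Z" by (auto simp: mspace_cylinder)
    with Suc show ?case
      unfolding h_simps using sel[of "h x n" "(x, real n)" "(x, real (Suc n))"]
      by (auto simp: mspace_cylinder)
  qed
  have h_step: "mdist A (h x n) (h x (Suc n)) \<le> S" if "(x, real (Suc n)) \<in> mspace ?Z" for x n
  proof -
    have "(x, real n) \<in> mspace ?Z" using that by (auto simp: mspace_cylinder)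
    then show ?thesis unfolding h_simps
      using sel[of "h x n" "(x, real n)" "(x, real (Suc n))"] h[of x n] that
      by (auto simp: mspace_cylinder)
  qed
  have h_steps: "mdist A (h x m) (h x (m + k)) \<le> S * k" if "(x, real (m + k)) \<in> mspace ?Z" for x m k
    using that
  proof (induction k)
    case 0
    then show ?case using h[of x m] by simp
  next
    case (Suc k)
    then have Z: "(x, real m) \<in> mspace ?Z" "(x, real (m + k)) \<in> mspace ?Z"
      by (auto simp: mspace_cylinder)
    have "mdist A (h x m) (h x (m + Suc k))
        \<le> mdist A (h x m) (h x (m + k)) + mdist A (h x (m + k)) (h x (m + Suc k))"
      using mdist_triangle h Z Suc.prems by metis
    also have "\<dots> \<le> S * k + S"
      using Suc Z h_step[of x "m + k"] by (intro add_mono) auto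
    finally show ?case by (simp add: algebra_simps)
  qed
  \<comment> \<open>Height 0 is treated separately, because \<open>sel\<close> could pick another
    point over \<open>f (x, 0)\<close> near \<open>f0 x\<close>. At a positive integer height,
    \<open>g\<close> need not equal \<open>h\<close>, but is within \<open>S\<close> of it.\<close>
  define g where
    "g = (\<lambda>(x, t). if t = 0 then f0 x else sel (h x (nat \<lfloor>t\<rfloor>)) (f (x, t)))"
  have g: "g (x, t) \<in> mspace A \<and> \<pi> (g (x, t)) = f (x, t) \<and>
      mdist A (h x (nat \<lfloor>t\<rfloor>)) (g (x, t)) \<le> S" and fl: "(x, real (nat \<lfloor>t\<rfloor>)) \<in> mspace ?Z"
    if "(x, t) \<in> mspace ?Z" for x t
  proof -
    have t: "x \<in> mspace X" "0 \<le> t" "real (nat \<lfloor>t\<rfloor>) \<le> t" "t - real (nat \<lfloor>t\<rfloor>) \<le> 1"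
      using that by (auto simp: mspace_cylinder) linarith+
    then show Z: "(x, real (nat \<lfloor>t\<rfloor>)) \<in> mspace ?Z"
      using that by (auto simp: mspace_cylinder)
    show "g (x, t) \<in> mspace A \<and> \<pi> (g (x, t)) = f (x, t) \<and> mdist A (h x (nat \<lfloor>t\<rfloor>)) (g (x, t)) \<le> S"
    proof (cases "t = 0")
      case True
      then show ?thesis using memf0 start t S(1) by (simp add: g_def h_simps)
    next
      case False
      then show ?thesis using sel[of "h x (nat \<lfloor>t\<rfloor>)" "(x, real (nat \<lfloor>t\<rfloor>))" "(x, t)"] h[OF Z] that Z t
        by (simp add: g_def)
    qed
  qed
  have horizontal: "\<exists>C. \<forall>x y n. (x, real n) \<in> mspace ?Z \<longrightarrow> (y, real n) \<in> mspace ?Z \<longrightarrow>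
      mdist X x y \<le> R \<longrightarrow> mdist A (h x n) (h y n) \<le> C" for R
  proof -
    obtain C0 where C0: "C0 > 0" "\<And>x y. \<lbrakk>x \<in> mspace X; y \<in> mspace X; mdist X x y \<le> R\<rbrakk>
        \<Longrightarrow> mdist A (f0 x) (f0 y) \<le> C0"
      using bornologous_mapD[OF f0] by blast
    obtain Q' where Q': "Q' > 0" "\<And>z w. \<lbrakk>z \<in> mspace ?Z; w \<in> mspace ?Z; mdist ?Z z w \<le> R\<rbrakk>
        \<Longrightarrow> mdist B (f z) (f w) \<le> Q'"
      using bornologous_mapD[OF bf] by blast
    obtain S' where S': "S' > 0" "\<And>a b. \<lbrakk>a \<in> mspace A; b \<in> mspace B; mdist B (\<pi> a) b \<le> Q'\<rbrakk>
        \<Longrightarrow> \<exists>a'\<in>mspace A. \<pi> a' = b \<and> mdist A a a' \<le> S'"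
      using sq Q'(1) unfolding soft_quotient_map_def by metis
    \<comment> \<open>\<open>C0\<close> handles height 0 and \<open>S'\<close> every later height.
      The scale \<open>S' + S + C + S\<close> is the length of the detour from \<open>a\<close> via
      \<open>h x (Suc n)\<close>, \<open>h x n\<close> and \<open>h y n\<close> to
      \<open>h y (Suc n)\<close>.\<close>
    define C where "C = max C0 S'"
    have "S' + S + C + S > 0" using S(1) S'(1) C0(1) by (auto simp: C_def)
    then obtain K where K: "bounded_in B K" "\<And>a a'. \<lbrakk>a \<in> mspace A; a' \<in> mspace A; \<pi> a = \<pi> a';
        \<pi> a \<notin> K; mdist A a a' \<le> S' + S + C + S\<rbrakk> \<Longrightarrow> a = a'"
      using sf unfolding scattered_fibres_def by metis
    obtain b where b: "\<And>x s t. \<lbrakk>(x, s) \<in> mspace ?Z; f (x, s) \<in> K; (x, t) \<in> mspace ?Z\<rbrakk> \<Longrightarrow> t \<le> b"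
      using bounded_column_height[OF f K(1)] by blast
    have good: "mdist A (h x n) (h y n) \<le> C"
      if "(x, real n) \<in> mspace ?Z" "(y, real n) \<in> mspace ?Z" "mdist X x y \<le> R"
        "\<And>k. k \<le> n \<Longrightarrow> f (y, real k) \<notin> K" for x y n
      using that
    proof (induction n)
      case 0
      then show ?case using C0(2) by (force simp: h_simps C_def mspace_cylinder)
    next
      case (Suc n)
      then have Z: "(x, real n) \<in> mspace ?Z" "(y, real n) \<in> mspace ?Z"
        by (auto simp: mspace_cylinder)
      have IH: "mdist A (h x n) (h y n) \<le> C" using Suc Z by auto
      have "mdist ?Z (x, real (Suc n)) (y, real (Suc n)) \<le> R"
        using Suc.prems(3) by (simp add: mdist_cylinder)
      \<comment> \<open>Softness at scale \<open>Q'\<close> gives a point over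
        \<open>f (y, real (Suc n))\<close> within \<open>S'\<close> of the lift in column
        \<open>x\<close>; scatteredness will identify it with \<open>h y (Suc n)\<close>.\<close>
      then obtain a where a: "a \<in> mspace A" "\<pi> a = f (y, real (Suc n))" "mdist A (h x (Suc n)) a \<le> S'"
        using S'(2)[of "h x (Suc n)" "f (y, real (Suc n))"] Q'(2) h memf Suc.prems by metis
      note m = h[OF Z(1)] h[OF Z(2)] h[OF Suc.prems(1)] h[OF Suc.prems(2)] a(1)
      have "mdist A a (h y (Suc n)) \<le> mdist A a (h x (Suc n)) + mdist A (h x (Suc n)) (h x n)
          + mdist A (h x n) (h y n) + mdist A (h y n) (h y (Suc n))"
        using m mdist_triangle[of a A "h x (Suc n)" "h y (Suc n)"]
          mdist_triangle[of "h x (Suc n)" A "h x n" "h y (Suc n)"]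
          mdist_triangle[of "h x n" A "h y n" "h y (Suc n)"] by simp
      also have "\<dots> \<le> S' + S + C + S"
        using a(3) IH h_step[OF Suc.prems(1)] h_step[OF Suc.prems(2)]
        by (intro add_mono) (simp_all add: mdist_commute)
      finally have "a = h y (Suc n)"
        using K(2)[of a "h y (Suc n)"] m a(2) Suc.prems(4)[of "Suc n"] by simp
      then show ?case using a(3) by (simp add: C_def)
    qed
    \<comment> \<open>Descend to height 0 in column \<open>x\<close>, cross over at cost
      \<open>C0\<close>, and climb column \<open>y\<close>. Column \<open>y\<close> meets the
      preimage of \<open>K\<close>, so \<open>n\<close> is at most \<open>b\<close>.\<close>
    have bad: "mdist A (h x n) (h y n) \<le> S * b + C0 + S * b"
      if Z: "(x, real n) \<in> mspace ?Z" "(y, real n) \<in> mspace ?Z" and R: "mdist X x y \<le> R"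
        and k: "k \<le> n" "f (y, real k) \<in> K" for x y n k
    proof -
      have Z0: "(x, real 0) \<in> mspace ?Z" "(y, real 0) \<in> mspace ?Z" "(y, real k) \<in> mspace ?Z"
        using Z k by (auto simp: mspace_cylinder)
      note m = h[OF Z(1)] h[OF Z(2)] h[OF Z0(1)] h[OF Z0(2)]
      have "mdist A (h x n) (h y n)
          \<le> mdist A (h x n) (h x 0) + mdist A (h x 0) (h y 0) + mdist A (h y 0) (h y n)"
        using m mdist_triangle[of "h x n" A "h x 0" "h y n"]
          mdist_triangle[of "h x 0" A "h y 0" "h y n"] by simp
      also have "\<dots> \<le> S * n + C0 + S * n"
        using h_steps[of x 0 n] h_steps[of y 0 n] Z Z0 C0(2)[of x y] R
        by (intro add_mono) (auto simp: mdist_commute h_simps mspace_cylinder)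
      also have "\<dots> \<le> S * b + C0 + S * b"
        using b[OF Z0(3) k(2) Z(2)] S(1) by (intro add_mono mult_left_mono) auto
      finally show ?thesis .
    qed
    have "mdist A (h x n) (h y n) \<le> max C (S * b + C0 + S * b)"
      if "(x, real n) \<in> mspace ?Z" "(y, real n) \<in> mspace ?Z" "mdist X x y \<le> R" for x y n
      using good[OF that] bad[OF that] by (meson max.coboundedI1 max.coboundedI2)
    then show ?thesis by blast
  qed
  \<comment> \<open>At most \<open>q + 1\<close> integer steps of cost \<open>S\<close>, and one
    more \<open>S\<close> from the floor of \<open>t\<close> to \<open>t\<close>.\<close>
  have vertical: "mdist A (h x m) (g (x, t)) \<le> S * (q + 2)"
    if Z: "(x, t) \<in> mspace ?Z" and m: "real m \<le> t" "t \<le> real m + q + 1" for x t m q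
  proof -
    obtain k where k: "nat \<lfloor>t\<rfloor> = m + k"
      using m(1) by (metis le_Suc_ex le_floor_iff nat_floor_neg nat_mono of_int_of_nat_eq nat_int)
    have kq: "real k \<le> q + 1" using k m(2) Z by (auto simp: mspace_cylinder) linarith
    have Zm: "(x, real m) \<in> mspace ?Z" using Z m by (auto simp: mspace_cylinder)
    have Zk: "(x, real (m + k)) \<in> mspace ?Z" using fl[OF Z] k by simp
    have "mdist A (h x m) (g (x, t)) \<le> mdist A (h x m) (h x (m + k)) + mdist A (h x (m + k)) (g (x, t))"
      using mdist_triangle h[OF Zm] h[OF Zk] g[OF Z] by metis
    also have "\<dots> \<le> S * k + S"
      using h_steps[OF Zk] g[OF Z] k by (intro add_mono) auto
    also have "\<dots> \<le> S * (q + 1) + S"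
      using kq S(1) by (intro add_mono mult_left_mono) auto
    finally show ?thesis by (simp add: algebra_simps)
  qed
  have bg: "bornologous_map ?Z A g"
    unfolding bornologous_map_alt
  proof (intro conjI allI)
    show "g \<in> mspace ?Z \<rightarrow> mspace A" using g by auto
    fix R
    obtain C where C: "\<And>x y n. \<lbrakk>(x, real n) \<in> mspace ?Z; (y, real n) \<in> mspace ?Z; mdist X x y \<le> R\<rbrakk>
        \<Longrightarrow> mdist A (h x n) (h y n) \<le> C"
      using horizontal[of R] by blast
    have "mdist A (g (x, s)) (g (y, t)) \<le> S * (R + 2) + C + S * (R + 2)"
      if Z: "(x, s) \<in> mspace ?Z" "(y, t) \<in> mspace ?Z" and R: "mdist ?Z (x, s) (y, t) \<le> R" for x s y t
    proof -
      \<comment> \<open>Both \<open>s\<close> and \<open>t\<close> lie between \<open>m\<close> and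
        \<open>m + R + 1\<close>, so the columns are compared at the common integer height
        \<open>m\<close>, and \<open>vertical\<close> applies with \<open>q = R\<close> on both
        sides.\<close>
      define m where "m = nat \<lfloor>min s t\<rfloor>"
      have st: "\<bar>s - t\<bar> \<le> R" and xy: "mdist X x y \<le> R"
        using mdist_cylinder_ge R by (meson order_trans)+
      have pos: "0 \<le> s" "0 \<le> t" using Z by (auto simp: mspace_cylinder)
      then have "real m \<le> min s t" "min s t \<le> real m + 1"
        unfolding m_def by linarith+
      then have m: "real m \<le> s" "real m \<le> t" "s \<le> real m + R + 1" "t \<le> real m + R + 1"
        using st by linarith+
      have Zm: "(x, real m) \<in> mspace ?Z" "(y, real m) \<in> mspace ?Z"
        using Z m by (auto simp: mspace_cylinder)
      have "mdist A (g (x, s)) (g (y, t)) \<le> mdist A (g (x, s)) (h x m) + mdist A (h x m) (h y m)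
          + mdist A (h y m) (g (y, t))"
        using g[OF Z(1)] g[OF Z(2)] h[OF Zm(1)] h[OF Zm(2)]
          mdist_triangle[of "g (x, s)" A "h x m" "g (y, t)"]
          mdist_triangle[of "h x m" A "h y m" "g (y, t)"] by simp
      also have "\<dots> \<le> S * (R + 2) + C + S * (R + 2)"
        using vertical[OF Z(1) m(1,3)] vertical[OF Z(2) m(2,4)] C[OF Zm xy]
        by (intro add_mono) (simp_all add: mdist_commute)
      finally show ?thesis .
    qed
    then show "\<exists>C. \<forall>z\<in>mspace ?Z. \<forall>w\<in>mspace ?Z. mdist ?Z z w \<le> R \<longrightarrow> mdist A (g z) (g w) \<le> C"
      by fast
  qed
  show thesis
  proof (rule that)
    show lift: "\<pi> (g z) = f z" if "z \<in> mspace ?Z" for z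
      using g that by (cases z) auto
    show "g (x, 0) = f0 x" for x by (simp add: g_def)
    have "coarse_map ?Z A g"
      using sq f bg lift
      by (intro coarse_map_comp_factor[of A B \<pi> ?Z g f])
        (auto simp: soft_quotient_map_def coarse_homotopy_def)
    then show "coarse_homotopy X p A g" using f by (simp add: coarse_homotopy_def)
  qed
qed

theorem theorem3p4:
  fixes A :: "'a metric" and B :: "'b metric" and X :: "'x metric"
    and \<pi> :: "'a \<Rightarrow> 'b" and p :: "'x \<Rightarrow> real"
    and f :: "'x \<times> real \<Rightarrow> 'b" and f0 :: "'x \<Rightarrow> 'a"
  assumes "soft_quotient_map A B \<pi>" and "scattered_fibres A B \<pi>"
    and "coarse_map X (ray_metric (-1)) p"
    and "coarse_homotopy X p B f"
    and "coarse_map X A f0"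
    and "\<forall>x\<in>mspace X. (f \<circ> cyl_incl) x = (\<pi> \<circ> f0) x"
  shows "(\<exists>g. coarse_homotopy X p A g \<and>
            (\<forall>x\<in>mspace X. (g \<circ> cyl_incl) x = f0 x) \<and>
            (\<forall>z\<in>mspace (cylinder X p). (\<pi> \<circ> g) z = f z)) \<and>
         (\<forall>g g'. coarse_homotopy X p A g \<and> coarse_homotopy X p A g' \<and>
            (\<forall>x\<in>mspace X. (g \<circ> cyl_incl) x = f0 x \<and> (g' \<circ> cyl_incl) x = f0 x) \<and>
            (\<forall>z\<in>mspace (cylinder X p). (\<pi> \<circ> g) z = f z \<and> (\<pi> \<circ> g') z = f z) \<longrightarrow>
            (\<exists>K. bounded_in (cylinder X p) K \<and>
               (\<forall>z\<in>mspace (cylinder X p) - K. g z = g' z)))"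
proof (rule conjI)
  have "\<pi> (f0 x) = f (x, 0)" if "x \<in> mspace X" for x
    using assms(6) that by (simp add: cyl_incl_def)
  then obtain g where "coarse_homotopy X p A g" "\<And>x. x \<in> mspace X \<Longrightarrow> g (x, 0) = f0 x"
    "\<And>z. z \<in> mspace (cylinder X p) \<Longrightarrow> \<pi> (g z) = f z"
    using coarse_homotopy_lift_exists[OF assms(1,2,4)] assms(5) unfolding coarse_map_def by blast
  then show "\<exists>g. coarse_homotopy X p A g \<and> (\<forall>x\<in>mspace X. (g \<circ> cyl_incl) x = f0 x) \<and>
      (\<forall>z\<in>mspace (cylinder X p). (\<pi> \<circ> g) z = f z)"
    by (auto simp: cyl_incl_def)
qed (use coarse_homotopy_lifts_eq[OF assms(2,4)] in \<open>simp add: cyl_incl_def\<close>)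

end
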